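(* Let $1\le p<\infty$ and $1\le r\le p^*$, where $p^*$ denotes the conjugate index of $p$. A sequence $(x_n)$ in a Banach space $X$ is $(p,r)$-null if and only if $(x_n)$ is null (i.e. $x_n\to 0$ in norm) and relatively $(p,r)$-compact.
   Context: Banach spaces are over a fixed field, $\mathbb R$ or $\mathbb C$. Conjugate index: $1/p+1/p^*=1$, with $1/\infty=0$. Convention: $\ell_\infty$ denotes $c_0$. $B_Z$ is the closed unit ball of $Z$. $\ell_p(X)$ is the Banach space of absolutely $p$-summable sequences in $X$ with norm $\|(x_k)\|_p=(\sum_k\|x_k\|^p)^{1/p}$. The $(p,r)$-convex hull of $(x_k)\in\ell_p(X)$ is $(p,r)\text{-conv}(x_k)=\{\sum_{k=1}^\infty a_kx_k:(a_k)\in B_{\ell_r}\}$ (so for $r=\infty$ the coefficients range over $B_{c_0}$). A subset $K\subset X$ is relatively $(p,r)$-compact if $K\subset (p,r)\text{-conv}(z_k)$ for some $(z_k)\in\ell_p(X)$; a sequence is relatively $(p,r)$-compact if the set of its terms is. A sequence $(x_n)$ in $X$ is $(p,r)$-null if for every $\varepsilon>0$ there exist $(z_k)\in\varepsilon B_{\ell_p(X)}$ and $N\in\mathbb N$ such that $x_n\in(p,r)\text{-conv}(z_k)$ for all $n\ge N$. *)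

theory Defs
  imports "HOL-Analysis.Analysis"
begin

(* Up to isometric isomorphism the fields of sort {real_normed_field, heine_borel} are
   the reals and the complex numbers, so this locale describes Banach spaces over either
   of them. The class banach supplies the complete norm (every complex Banach space is
   in particular a real one); the vector space structure over the scalar field is smul. *)
locale banach_space_over = vector_space smul
  for smul :: "'k::{real_normed_field, heine_borel} \<Rightarrow> 'a::banach \<Rightarrow> 'a" +
  assumes norm_scale: "norm (smul c x) = norm c * norm x"

lemma banach_space_over_real:
  "banach_space_over (scaleR :: real \<Rightarrow> 'a::banach \<Rightarrow> 'a)"
  by unfold_locales (auto simp: algebra_simps)

lemma banach_space_over_complex:
  "banach_space_over ((*) :: complex \<Rightarrow> complex \<Rightarrow> complex)"
  by unfold_locales (auto simp: algebra_simps norm_mult)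

(* Exponents are extended reals in [1, \<infinity>]; for the exponent \<infinity> the space is c_0,
   with the supremum norm. *)
definition lp_seqs :: "ereal \<Rightarrow> (nat \<Rightarrow> 'b::real_normed_vector) set" where
  "lp_seqs p = (if p = \<infinity> then {x. x \<longlonglongrightarrow> 0}
                else {x. summable (\<lambda>k. norm (x k) powr real_of_ereal p)})"

definition lp_norm :: "ereal \<Rightarrow> (nat \<Rightarrow> 'b::real_normed_vector) \<Rightarrow> real" where
  "lp_norm p x = (if p = \<infinity> then (SUP k. norm (x k))
                  else (\<Sum>k. norm (x k) powr real_of_ereal p) powr (1 / real_of_ereal p))"

definition lp_ball :: "ereal \<Rightarrow> real \<Rightarrow> (nat \<Rightarrow> 'b::real_normed_vector) set" where
  "lp_ball p e = {x \<in> lp_seqs p. lp_norm p x \<le> e}"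

(* The (p,r)-convex hull of z. The exponent p enters only through the requirement that z
   lie in lp_seqs p, which is imposed where the hull is used. *)
definition pr_conv ::
  "('k::{real_normed_field, heine_borel} \<Rightarrow> 'a::banach \<Rightarrow> 'a) \<Rightarrow> ereal \<Rightarrow> (nat \<Rightarrow> 'a) \<Rightarrow> 'a set" where
  "pr_conv smul r z = {y. \<exists>a \<in> lp_ball r 1. (\<lambda>k. smul (a k) (z k)) sums y}"

definition rel_pr_compact ::
  "('k::{real_normed_field, heine_borel} \<Rightarrow> 'a::banach \<Rightarrow> 'a) \<Rightarrow> ereal \<Rightarrow> ereal \<Rightarrow> 'a set \<Rightarrow> bool" where
  "rel_pr_compact smul p r K \<longleftrightarrow> (\<exists>z \<in> lp_seqs p. K \<subseteq> pr_conv smul r z)"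

definition pr_null ::
  "('k::{real_normed_field, heine_borel} \<Rightarrow> 'a::banach \<Rightarrow> 'a) \<Rightarrow> ereal \<Rightarrow> ereal \<Rightarrow> (nat \<Rightarrow> 'a) \<Rightarrow> bool" where
  "pr_null smul p r x \<longleftrightarrow>
     (\<forall>\<epsilon>>0. \<exists>z \<in> lp_ball p \<epsilon>. \<exists>N. \<forall>n\<ge>N. x n \<in> pr_conv smul r z)"

end

theory Submission
  imports Defs
begin

text \<open>
  For the nontrivial direction write $x_n = \sum_k a^n_k z_k$ with coefficient sequences in a
  coordinatewise compact ball. Since $r \le p^*$, the tails of these series are uniformly small, so
  every coordinatewise limit point $b$ of $(a^n)$ satisfies $\sum_k b_k z_k = 0$; hence for large $n$
  such a $b$ exists that agrees with $a^n$ up to any given error on the first $M$ coordinates. In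
  $x_n = \sum_k (a^n_k - b_k) z_k$ the first $M$ coefficients are now small, so $z_k$ may be replaced
  there by $\delta z_k$, while the remaining $z_k$ have small norm in $\ell_p$. For $r = \infty$ the
  limit $b$ is only bounded; writing $z_k = t_k w_k$ with $t_k \to 0$ and $(w_k) \in \ell_p$
  restores coefficients in $c_0$.
\<close>

text \<open>For the exponent \<open>\<infinity>\<close> this is the ball of bounded sequences rather than of
  $c_0$: the latter is not closed under coordinatewise limits.\<close>
definition coef_ball :: "ereal \<Rightarrow> (nat \<Rightarrow> 'b::real_normed_vector) set" where
  "coef_ball r = {a. if r = \<infinity> then \<forall>k. norm (a k) \<le> 1
                     else \<forall>n. (\<Sum>k<n. norm (a k) powr real_of_ereal r) \<le> 1}"

section \<open>Coefficient balls: finite-coordinate description and compactness\<close>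

text \<open>Taking the root of order \<open>R\<close> preserves comparison with 1, and nonnegative
  terms make bounded partial sums equivalent to a bounded series. The partial sums involve finitely
  many coordinates each, which is what coordinatewise limits require.\<close>

lemma suminf_powr_le_1_iff:
  fixes f :: "nat \<Rightarrow> real"
  assumes "R > 0" "\<And>k. f k \<ge> 0"
  shows "summable f \<and> suminf f powr (1 / R) \<le> 1 \<longleftrightarrow> (\<forall>n. sum f {..<n} \<le> 1)"
proof
  assume f: "summable f \<and> suminf f powr (1 / R) \<le> 1"
  have "suminf f \<le> 1"
  proof (rule ccontr)
    assume "\<not> suminf f \<le> 1"
    then have "1 < suminf f powr (1 / R)" using assms(1) by (simp add: powr_def)
    then show False using f by simp
  qed
  moreover have "sum f {..<n} \<le> suminf f" for n
    using f assms(2) by (intro sum_le_suminf) auto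
  ultimately show "\<forall>n. sum f {..<n} \<le> 1" by (meson order.trans)
next
  assume *: "\<forall>n. sum f {..<n} \<le> 1"
  have s: "summable f" using * assms(2) by (intro summableI_nonneg_bounded[of _ 1]) auto
  have "suminf f \<le> 1" using s * by (intro suminf_le_const) auto
  moreover have "0 \<le> suminf f" using s assms(2) by (intro suminf_nonneg) auto
  ultimately show "summable f \<and> suminf f powr (1 / R) \<le> 1"
    using s assms(1) by (simp add: powr_le1)
qed

text \<open>For finite \<open>r\<close> both balls coincide; for \<open>r = \<infinity>\<close> they
  differ exactly by convergence to 0, which therefore has to be recovered separately after a
  coordinatewise limit.\<close>

lemma lp_ball_1_iff:
  assumes "1 \<le> r"
  shows "a \<in> lp_ball r 1 \<longleftrightarrow> a \<in> coef_ball r \<and> (r = \<infinity> \<longrightarrow> a \<longlonglongrightarrow> 0)"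
proof (cases "r = \<infinity>")
  case True
  have "(SUP k. norm (a k)) \<le> 1 \<longleftrightarrow> (\<forall>k. norm (a k) \<le> 1)" if "a \<longlonglongrightarrow> 0"
  proof -
    \<comment> \<open>A real supremum can be compared termwise only over a family bounded above;
      convergence supplies the bound.\<close>
    have "bounded (range a)" using that convergent_imp_bounded by blast
    then have "bdd_above (range (\<lambda>k. norm (a k)))"
      by (auto simp: bounded_iff bdd_above_def)
    then show ?thesis by (subst cSUP_le_iff) auto
  qed
  then show ?thesis using True by (auto simp: lp_ball_def lp_seqs_def lp_norm_def coef_ball_def)
next
  case False
  then have "real_of_ereal r > 0" using assms by (cases r) auto
  from suminf_powr_le_1_iff[OF this, of "\<lambda>k. norm (a k) powr real_of_ereal r"] False
  show ?thesis by (auto simp: lp_ball_def lp_seqs_def lp_norm_def coef_ball_def)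
qed

lemma pr_convI:
  "a \<in> lp_ball r 1 \<Longrightarrow> (\<lambda>k. smul (a k) (z k)) sums y \<Longrightarrow> y \<in> pr_conv smul r z"
  by (auto simp: pr_conv_def)

lemma norm_le_1_if_coef_ball:
  assumes "1 \<le> r" "a \<in> coef_ball r"
  shows "norm (a k) \<le> 1"
proof (cases "r = \<infinity>")
  case True
  then show ?thesis using assms by (auto simp: coef_ball_def)
next
  case False
  define R where "R = real_of_ereal r"
  have R: "R > 0" using assms(1) False by (cases r) (auto simp: R_def)
  have "norm (a k) powr R \<le> (\<Sum>j<Suc k. norm (a j) powr R)"
    by (rule member_le_sum) auto
  also have "\<dots> \<le> 1"
    using assms(2) False unfolding coef_ball_def R_def by (simp del: sum.lessThan_Suc)
  finally have "norm (a k) powr R \<le> 1" .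
  then show ?thesis using R
    by (metis norm_ge_zero not_le one_le_numeral order_less_imp_le powr_less_mono2 powr_one_eq_one zero_le_one)
qed

text \<open>Each defining inequality of \<open>coef_ball\<close> is weak and continuous in finitely
  many coordinates, so it survives the limit.\<close>

lemma coef_ball_closed:
  assumes "\<And>n. f n \<in> coef_ball r" "\<And>k. (\<lambda>n. f n k) \<longlonglongrightarrow> b k" "1 \<le> r"
  shows "b \<in> coef_ball r"
proof (cases "r = \<infinity>")
  case True
  have "norm (b k) \<le> 1" for k
    using LIMSEQ_le_const2[OF tendsto_norm[OF assms(2)[of k]]] assms(1) True
    by (auto simp: coef_ball_def)
  then show ?thesis using True by (auto simp: coef_ball_def)
next
  case False
  define R where "R = real_of_ereal r"
  have R: "R > 0" using assms(3) False by (cases r) (auto simp: R_def)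
  have "(\<lambda>n. \<Sum>k<m. norm (f n k) powr R) \<longlonglongrightarrow> (\<Sum>k<m. norm (b k) powr R)" for m
    by (intro tendsto_sum tendsto_powr' tendsto_norm assms tendsto_const) (use R in auto)
  then have "(\<Sum>k<m. norm (b k) powr R) \<le> 1" for m
    by (rule LIMSEQ_le_const2) (use assms(1) False in \<open>auto simp: coef_ball_def R_def\<close>)
  then show ?thesis using False by (auto simp: coef_ball_def R_def)
qed

text \<open>Tychonoff: the entries lie in the closed unit ball of the scalar field, which is
  compact, and the countable product is metrizable, so compactness yields a convergent subsequence.
  Closedness of the ball keeps the limit inside.\<close>

lemma coef_ball_seq_compact:
  fixes f :: "nat \<Rightarrow> nat \<Rightarrow> 'k::{real_normed_field, heine_borel}"
  assumes "\<And>n. f n \<in> coef_ball r" "1 \<le> r"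
  obtains \<phi> :: "nat \<Rightarrow> nat" and b where "strict_mono \<phi>" "b \<in> coef_ball r" "\<And>k. (\<lambda>n. f (\<phi> n) k) \<longlonglongrightarrow> b k"
proof -
  let ?C = "PiE UNIV (\<lambda>_::nat. cball (0::'k) 1)"
  have "compactin (product_topology (\<lambda>_::nat. euclidean) UNIV) ?C"
    by (subst compactin_PiE) auto
  then have "compact ?C"
    by (simp add: euclidean_product_topology)
  then have "seq_compact ?C" by (simp add: compact_eq_seq_compact_metric)
  moreover have "\<forall>n. f n \<in> ?C"
    using norm_le_1_if_coef_ball[OF assms(2) assms(1)] by auto
  ultimately obtain \<phi> b where \<phi>: "strict_mono \<phi>" "(f \<circ> \<phi>) \<longlonglongrightarrow> b"
    unfolding seq_compact_def by metis
  have lim: "(\<lambda>n. f (\<phi> n) k) \<longlonglongrightarrow> b k" for k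
    using continuous_on_tendsto_compose[OF continuous_on_product_coordinates[of k] \<phi>(2)]
    by (simp add: o_def)
  show thesis
    by (rule that[OF \<phi>(1) coef_ball_closed[of "\<lambda>n. f (\<phi> n)"] lim]) (use assms lim in auto)
qed

section \<open>Two tools for real sequences\<close>

text \<open>Young's inequality is applied to \<open>z i / s\<close> and \<open>a i\<close>, where
  \<open>s\<close> is the \<open>p\<close>-norm of \<open>z\<close>; the two resulting sums are at
  most \<open>1/p\<close> and \<open>1/q\<close>.\<close>

lemma Holder_inequality_unit:
  fixes a z :: "'i \<Rightarrow> real"
  assumes "p > 1" "q > 1" "1/p + 1/q = 1"
    and "\<And>i. i \<in> F \<Longrightarrow> a i \<ge> 0" "\<And>i. i \<in> F \<Longrightarrow> z i \<ge> 0" "finite F"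
    and a: "(\<Sum>i\<in>F. a i powr q) \<le> 1"
  shows "(\<Sum>i\<in>F. a i * z i) \<le> (\<Sum>i\<in>F. z i powr p) powr (1/p)"
proof (cases "(\<Sum>i\<in>F. z i powr p) = 0")
  case True
  then have "\<forall>i\<in>F. z i = 0" using assms by (subst (asm) sum_nonneg_eq_0_iff) auto
  then show ?thesis by simp
next
  case False
  define S where "S = (\<Sum>i\<in>F. z i powr p)"
  define s where "s = S powr (1/p)"
  have S: "S > 0" using False sum_nonneg[of F "\<lambda>i. z i powr p"] by (auto simp: S_def)
  have s: "s > 0" "s powr p = S" using S assms by (auto simp: s_def powr_powr)
  have "(\<Sum>i\<in>F. a i * z i) = s * (\<Sum>i\<in>F. (z i / s) * a i)"
    using s by (simp add: sum_distrib_left mult.commute)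
  also have "(\<Sum>i\<in>F. (z i / s) * a i) \<le> (\<Sum>i\<in>F. (z i / s) powr p / p + a i powr q / q)"
    using assms s by (intro sum_mono Youngs_inequality) auto
  also have "\<dots> = (\<Sum>i\<in>F. z i powr p) / S / p + (\<Sum>i\<in>F. a i powr q) / q"
    using assms s by (simp add: sum.distrib sum_divide_distrib powr_divide)
  also have "\<dots> \<le> 1 / p + 1 / q"
    using a S assms by (intro add_mono divide_right_mono) (auto simp: S_def)
  finally show ?thesis using s assms by (simp add: S_def s_def)
qed

text \<open>The witness is the square root of the tails of the series, after adding a geometric series to
  keep the tails positive.\<close>
lemma summable_divide_null:
  fixes s :: "nat \<Rightarrow> real"
  assumes "summable s" "\<And>k. s k \<ge> 0"
  obtains t where "\<And>k. 0 < t k" "\<And>k. t k \<le> 1" "t \<longlonglongrightarrow> 0" "summable (\<lambda>k. s k / t k)"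
proof -
  define s' where "s' k = s k + (1/2)^k" for k
  have s'1: "summable s'"
    unfolding s'_def by (intro summable_add assms(1) summable_geometric) simp
  have s'2: "s' k > 0" for k
    unfolding s'_def using assms(2)[of k] by (intro add_nonneg_pos) auto
  note s' = s'1 s'2
  define R where "R n = (\<Sum>k. s' (k + n))" for n
  have R_Suc: "R n = s' n + R (Suc n)" for n
    using suminf_split_head[OF summable_ignore_initial_segment[OF s'(1), of n]]
    unfolding R_def add_Suc_right add_Suc by simp
  have R_pos: "R n > 0" for n
    unfolding R_def by (intro suminf_pos summable_ignore_initial_segment s')
  have "R (Suc n) \<le> R n" for n using R_Suc[of n] s'(2)[of n] by simp
  then have R_le: "R n \<le> R 0" for n
    using lift_Suc_antimono_le[of R 0 n] by simp
  have R_lim: "R \<longlonglongrightarrow> 0"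
    unfolding R_def lim_sequentially dist_norm using suminf_exist_split[OF _ s'(1)] by simp
  \<comment> \<open>Dividing by \<open>R 0\<close>, the largest tail, gives
    \<open>t n \<le> 1\<close>.\<close>
  define t where "t n = sqrt (R n / R 0)" for n
  \<comment> \<open>With \<open>x\<close> and \<open>y\<close> the two roots, \<open>s' n\<close> is
    \<open>x^2 - y^2\<close>, and \<open>x^2 - y^2 \<le> 2 * (x - y) * x\<close> merely says
    \<open>(x - y)^2 \<ge> 0\<close>. The resulting bound telescopes.\<close>
  have sq: "s' n / sqrt (R n) \<le> 2 * (sqrt (R n) - sqrt (R (Suc n)))" for n
  proof -
    let ?x = "sqrt (R n)" and ?y = "sqrt (R (Suc n))"
    have x: "?x > 0" "?y > 0" using R_pos by auto
    have "?x^2 - ?y^2 = s' n" using R_Suc[of n] R_pos[of n] R_pos[of "Suc n"] by simp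
    moreover have "u^2 - v^2 \<le> 2 * (u - v) * u" for u v :: real
      using zero_le_power2[of "u - v"] by (simp add: power2_eq_square algebra_simps)
    then have "?x^2 - ?y^2 \<le> 2 * (?x - ?y) * ?x" .
    ultimately show ?thesis using x by (simp add: divide_le_eq)
  qed
  have sR: "summable (\<lambda>n. sqrt (R n) - sqrt (R (Suc n)))"
    by (rule telescope_summable'[of _ "sqrt 0"]) (intro tendsto_real_sqrt R_lim)
  have "summable (\<lambda>n. s n / t n)"
  proof (rule summable_comparison_test')
    show "summable (\<lambda>n. sqrt (R 0) * (2 * (sqrt (R n) - sqrt (R (Suc n)))))"
      using sR by (intro summable_mult)
    fix n :: nat
    have "norm (s n / t n) = sqrt (R 0) * (s n / sqrt (R n))"
      using assms(2)[of n] R_pos by (simp add: t_def real_sqrt_divide less_imp_le)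
    also have "\<dots> \<le> sqrt (R 0) * (s' n / sqrt (R n))"
      using R_pos by (intro mult_left_mono divide_right_mono) (auto simp: s'_def less_imp_le)
    also have "\<dots> \<le> sqrt (R 0) * (2 * (sqrt (R n) - sqrt (R (Suc n))))"
      using R_pos sq by (intro mult_left_mono) (auto simp: less_imp_le)
    finally show "norm (s n / t n) \<le> sqrt (R 0) * (2 * (sqrt (R n) - sqrt (R (Suc n))))" .
  qed
  moreover have "t \<longlonglongrightarrow> sqrt (0 / R 0)"
    unfolding t_def using R_pos[of 0] by (intro tendsto_real_sqrt tendsto_divide R_lim tendsto_const) auto
  ultimately show thesis
    by (intro that[of t]) (use R_pos R_le in \<open>auto simp: t_def\<close>)
qed

section \<open>Conjugate exponents and uniform tail estimates\<close>

text \<open>The conjugate index is a parameter pinned down by \<open>conjugate\<close>. As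
  \<open>1 / \<infinity> = 0\<close> in \<open>ereal\<close>, the case \<open>p = 1\<close> is
  included and forces \<open>p_star = \<infinity>\<close>.\<close>

locale pr_indices = banach_space_over smul
  for smul :: "'k::{real_normed_field, heine_borel} \<Rightarrow> 'a::banach \<Rightarrow> 'a" +
  fixes p p_star r :: ereal
  assumes p_ge_1: "1 \<le> p" and p_finite: "p < \<infinity>"
    and p_star_ge_1: "1 \<le> p_star" and conjugate: "1 / p + 1 / p_star = 1"
    and r_ge_1: "1 \<le> r" and r_le: "r \<le> p_star"
begin

abbreviation P :: real where "P \<equiv> real_of_ereal p"

lemma P_ge_1: "P \<ge> 1" and p_eq: "p = ereal P"
  using p_ge_1 p_finite by (cases p; auto)+

text \<open>For \<open>P > 1\<close> the conjugate index is finite, hence so is \<open>r\<close>,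
  and Hoelder's inequality for real exponents applies. The value \<open>r = \<infinity>\<close> can
  occur only with \<open>P = 1\<close>.\<close>

lemma P_cases:
  obtains "P = 1" | Q where "P > 1" "Q > 1" "1/P + 1/Q = 1" "r \<noteq> \<infinity>" "real_of_ereal r \<le> Q"
proof (cases "P = 1")
  case False
  then have P: "P > 1" using P_ge_1 by simp
  have p: "p = ereal P" by (rule p_eq)
  obtain Q where Q: "p_star = ereal Q"
  proof (cases p_star)
    \<comment> \<open>An infinite conjugate index would force \<open>1 / P = 1\<close>.\<close>
    case PInf
    have "1 / p = ereal (1 / P)"
      using P by (subst p) (simp add: one_ereal_def)
    with PInf conjugate P show ?thesis by (simp add: one_ereal_def)
  qed (use p_star_ge_1 that in auto)
  have Q1: "Q \<ge> 1" using p_star_ge_1 Q by simp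
  have "ereal 1 / ereal P + ereal 1 / ereal Q = ereal 1"
    using conjugate Q by (simp add: p[symmetric] one_ereal_def)
  then have e: "1 / P + 1 / Q = 1" using P Q1 by simp
  have "Q \<noteq> 1" using e P by auto
  moreover have "r \<noteq> \<infinity>" "real_of_ereal r \<le> Q" using r_le r_ge_1 Q by (cases r; auto)+
  ultimately show ?thesis using that(2)[of Q] P Q1 e by simp
qed

text \<open>Here \<open>r \<le> p_star\<close> enters: entries of norm at most 1 have smaller powers
  for larger exponents, so a bound for the exponent \<open>r\<close> gives one for \<open>Q\<close>.
  For \<open>P = 1\<close> the bound 1 on the entries is enough.\<close>

lemma Holder_coef_ball:
  assumes a: "a \<in> coef_ball r"
  shows "(\<Sum>k\<in>{m..<n}. norm (a k) * norm (z k)) \<le> (\<Sum>k\<in>{m..<n}. norm (z k) powr P) powr (1 / P)"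
proof (cases rule: P_cases)
  case 1
  have "(\<Sum>k\<in>{m..<n}. norm (a k) * norm (z k)) \<le> (\<Sum>k\<in>{m..<n}. norm (z k))"
    using norm_le_1_if_coef_ball[OF r_ge_1 a] by (intro sum_mono mult_left_le_one_le) auto
  then show ?thesis using 1 by (simp add: sum_nonneg)
next
  case (2 Q)
  define R where "R = real_of_ereal r"
  have "(\<Sum>k\<in>{m..<n}. norm (a k) powr Q) \<le> (\<Sum>k\<in>{m..<n}. norm (a k) powr R)"
    using norm_le_1_if_coef_ball[OF r_ge_1 a] 2 by (intro sum_mono powr_mono') (auto simp: R_def)
  also have "\<dots> \<le> (\<Sum>k<n. norm (a k) powr R)"
    by (intro sum_mono2) auto
  also have "\<dots> \<le> 1" using a 2 by (auto simp: coef_ball_def R_def)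
  finally show ?thesis using 2 by (intro Holder_inequality_unit[of P Q]) auto
qed

text \<open>The bound depends on \<open>z\<close> and \<open>L\<close> but not on \<open>a\<close>,
  so tails are small uniformly over the coefficient ball. With \<open>L = 0\<close> it bounds
  \<open>y\<close> by the norm of \<open>z\<close> in the \<open>p\<close>-summable
  sequences.\<close>

lemma norm_smul_tail_le:
  assumes a: "a \<in> coef_ball r" and z: "summable (\<lambda>k. norm (z k) powr P)"
    and y: "(\<lambda>k. smul (a k) (z k)) sums y"
  shows "norm (y - (\<Sum>k<L. smul (a k) (z k))) \<le> (\<Sum>k. norm (z (k + L)) powr P) powr (1 / P)"
proof -
  have bound: "norm ((\<Sum>k<n. smul (a k) (z k)) - (\<Sum>k<L. smul (a k) (z k)))
      \<le> (\<Sum>k. norm (z (k + L)) powr P) powr (1 / P)" if "L \<le> n" for n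
  proof -
    have "(\<Sum>k<n. smul (a k) (z k)) - (\<Sum>k<L. smul (a k) (z k)) = (\<Sum>k\<in>{L..<n}. smul (a k) (z k))"
      using sum_diff_nat_ivl[of 0 L n "\<lambda>k. smul (a k) (z k)"] that by (simp add: lessThan_atLeast0)
    also have "norm \<dots> \<le> (\<Sum>k\<in>{L..<n}. norm (a k) * norm (z k))"
      by (rule order.trans[OF norm_sum]) (simp add: norm_scale)
    also have "\<dots> \<le> (\<Sum>k\<in>{L..<n}. norm (z k) powr P) powr (1 / P)"
      by (rule Holder_coef_ball[OF a])
    also have "(\<Sum>k\<in>{L..<n}. norm (z k) powr P) = (\<Sum>k<n-L. norm (z (k + L)) powr P)"
      using sum.shift_bounds_nat_ivl[of "\<lambda>k. norm (z k) powr P" 0 L "n - L"] that by (simp add: lessThan_atLeast0)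
    also have "\<dots> powr (1 / P) \<le> (\<Sum>k. norm (z (k + L)) powr P) powr (1 / P)"
      using P_ge_1 z by (intro powr_mono2 sum_le_suminf sum_nonneg) (auto simp: summable_iff_shift[of "\<lambda>k. norm (z k) powr P"])
    finally show ?thesis .
  qed
  have "(\<lambda>n. norm ((\<Sum>k<n. smul (a k) (z k)) - (\<Sum>k<L. smul (a k) (z k))))
      \<longlonglongrightarrow> norm (y - (\<Sum>k<L. smul (a k) (z k)))"
    using y unfolding sums_def by (intro tendsto_intros)
  then show ?thesis by (rule LIMSEQ_le_const2) (use bound in blast)
qed

lemma tail_tendsto_0:
  assumes "summable (\<lambda>k. norm (z k) powr P)"
  shows "(\<lambda>L. (\<Sum>k. norm (z (k + L)) powr P) powr (1 / P)) \<longlonglongrightarrow> 0"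
proof -
  have "(\<lambda>L. \<Sum>k. norm (z (k + L)) powr P) \<longlonglongrightarrow> 0"
    unfolding lim_sequentially dist_norm using suminf_exist_split[OF _ assms] by simp
  then have "(\<lambda>L. (\<Sum>k. norm (z (k + L)) powr P) powr (1 / P)) \<longlonglongrightarrow> 0 powr (1 / P)"
    using P_ge_1 by (intro tendsto_powr2 tendsto_const always_eventually allI suminf_nonneg)
      (auto simp: summable_iff_shift[of "\<lambda>k. norm (z k) powr P"] assms)
  then show ?thesis by simp
qed

lemma tendsto_smul: "(f \<longlongrightarrow> c) F \<Longrightarrow> ((\<lambda>n. smul (f n) v) \<longlongrightarrow> smul c v) F"
proof -
  assume f: "(f \<longlongrightarrow> c) F"
  have "((\<lambda>n. norm (f n - c) * norm v) \<longlongrightarrow> 0 * norm v) F"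
    using f by (intro tendsto_mult tendsto_const tendsto_norm_zero LIM_zero)
  then have "((\<lambda>n. norm (smul (f n - c) v)) \<longlongrightarrow> 0) F"
    by (simp add: norm_scale)
  then show ?thesis
    by (simp add: scale_left_diff_distrib tendsto_norm_zero_iff LIM_zero_iff)
qed

section \<open>Approximation by coefficients of the zero vector\<close>

text \<open>If infinitely many indices failed, compactness would give a coordinatewise limit
  \<open>b\<close> along a subsequence of them. This \<open>b\<close> represents 0 and is close to
  late members of the subsequence on the first \<open>M\<close> coordinates, a
  contradiction.\<close>

lemma eventually_near_kernel:
  assumes z: "summable (\<lambda>k. norm (z k) powr P)" and x: "x \<longlonglongrightarrow> 0"
    and a: "\<And>n. a n \<in> coef_ball r" "\<And>n. (\<lambda>k. smul (a n k) (z k)) sums x n" and "\<eta> > 0"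
  shows "\<forall>\<^sub>F n in sequentially. \<exists>b \<in> coef_ball r. (\<lambda>k. smul (b k) (z k)) sums 0 \<and> (\<forall>k<M. norm (a n k - b k) < \<eta>)"
    (is "eventually ?Q _")
proof (rule ccontr)
  assume "\<not> eventually ?Q sequentially"
  then have "infinite {n. \<not> ?Q n}"
    unfolding cofinite_eq_sequentially[symmetric] eventually_cofinite .
  then obtain \<psi> :: "nat \<Rightarrow> nat" where \<psi>: "strict_mono \<psi>" "\<And>n. \<psi> n \<in> {n. \<not> ?Q n}"
    using infinite_enumerate by blast
  obtain \<phi> b where \<phi>: "strict_mono \<phi>" and b: "b \<in> coef_ball r"
    and lim: "\<And>k. (\<lambda>n. a (\<psi> (\<phi> n)) k) \<longlonglongrightarrow> b k"
    using coef_ball_seq_compact[of "\<lambda>n. a (\<psi> n)", OF a(1) r_ge_1] by metis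
  define \<theta> where "\<theta> = \<psi> \<circ> \<phi>"
  have \<theta>: "strict_mono \<theta>" using \<psi> \<phi> by (simp add: \<theta>_def strict_mono_o)
  have lim: "(\<lambda>n. a (\<theta> n) k) \<longlonglongrightarrow> b k" for k using lim by (simp add: \<theta>_def)
  have xlim: "(\<lambda>n. x (\<theta> n)) \<longlonglongrightarrow> 0" using LIMSEQ_subseq_LIMSEQ[OF x \<theta>] by (simp add: o_def)
  \<comment> \<open>For fixed \<open>L\<close> the uniform tail estimate passes to the limit along
    \<open>\<theta>\<close>, where \<open>x\<close> vanishes. Letting \<open>L\<close> grow then
    shows that the series of \<open>b\<close> sums to 0.\<close>
  have bound: "norm (\<Sum>k<L. smul (b k) (z k)) \<le> (\<Sum>k. norm (z (k + L)) powr P) powr (1 / P)" for L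
  proof -
    have "(\<lambda>n. norm (x (\<theta> n) - (\<Sum>k<L. smul (a (\<theta> n) k) (z k)))) \<longlonglongrightarrow> norm (0 - (\<Sum>k<L. smul (b k) (z k)))"
      by (intro tendsto_norm tendsto_diff xlim tendsto_sum tendsto_smul lim)
    from LIMSEQ_le_const2[OF this] norm_smul_tail_le[OF a(1) z a(2)] show ?thesis by simp
  qed
  have "(\<lambda>L. \<Sum>k<L. smul (b k) (z k)) \<longlonglongrightarrow> 0"
    by (rule Lim_null_comparison[OF _ tail_tendsto_0[OF z]]) (use bound in auto)
  then have b0: "(\<lambda>k. smul (b k) (z k)) sums 0" by (simp add: sums_def)
  have "\<forall>\<^sub>F n in sequentially. \<forall>k\<in>{..<M}. norm (a (\<theta> n) k - b k) < \<eta>"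
    by (intro eventually_ball_finite ballI) (use lim \<open>\<eta> > 0\<close> in \<open>auto simp: tendsto_iff dist_norm\<close>)
  then obtain n where "\<forall>k\<in>{..<M}. norm (a (\<theta> n) k - b k) < \<eta>"
    using eventually_happens'[OF sequentially_bot] by blast
  then have "?Q (\<theta> n)" by (intro bexI[OF _ b] conjI b0) simp
  moreover have "\<not> ?Q (\<theta> n)" using \<psi>(2)[of "\<phi> n"] unfolding \<theta>_def o_def by (rule CollectD)
  ultimately show False by contradiction
qed

section \<open>From \<open>pr_null\<close> to norm convergence and relative compactness\<close>

lemma pr_null_imp_tendsto_0:
  assumes "pr_null smul p r x"
  shows "x \<longlonglongrightarrow> 0"
proof (rule LIMSEQ_I)
  fix e :: real assume "e > 0"
  \<comment> \<open>The hull estimate is a weak inequality, so half of \<open>e\<close> is used to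
    get a strict one.\<close>
  then have "e / 2 > 0" by simp
  then obtain z N where z: "z \<in> lp_ball p (e/2)" and N: "\<And>n. n \<ge> N \<Longrightarrow> x n \<in> pr_conv smul r z"
    using assms unfolding pr_null_def by meson
  have zs: "summable (\<lambda>k. norm (z k) powr P)" and zn: "(\<Sum>k. norm (z k) powr P) powr (1 / P) \<le> e / 2"
    using z p_finite by (auto simp: lp_ball_def lp_seqs_def lp_norm_def split: if_splits)
  have "norm (x n - 0) < e" if n: "n \<ge> N" for n
  proof -
    obtain a where a: "a \<in> lp_ball r 1" "(\<lambda>k. smul (a k) (z k)) sums x n"
      using N[OF n] by (auto simp: pr_conv_def)
    have "a \<in> coef_ball r" using a(1) lp_ball_1_iff[OF r_ge_1] by blast
    from norm_smul_tail_le[OF this zs a(2), of 0] zn \<open>e > 0\<close> show ?thesis by simp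
  qed
  then show "\<exists>no. \<forall>n\<ge>no. norm (x n - 0) < e" by blast
qed

lemma unit_vector_in_lp_ball: "(\<lambda>k. if k = n then 1 else 0 :: 'k) \<in> lp_ball r 1"
proof -
  have "(\<Sum>k<m. norm (if k = n then 1 else 0 :: 'k) powr R) \<le> 1" for m R
    by (simp add: if_distrib[of norm] if_distrib[of "\<lambda>y. y powr R"] sum.delta cong: if_cong)
  moreover have "(\<lambda>k. if k = n then 1 else 0 :: 'k) \<longlonglongrightarrow> 0"
    by (rule tendsto_eventually) (auto simp: eventually_sequentially intro: exI[of _ "Suc n"])
  ultimately show ?thesis by (subst lp_ball_1_iff[OF r_ge_1]) (auto simp: coef_ball_def)
qed

text \<open>Frees the first \<open>N\<close> positions, so that finitely many vectors can be put in
  front of a sequence.\<close>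

lemma shift_in_lp_ball:
  fixes a :: "nat \<Rightarrow> 'k"
  assumes "a \<in> lp_ball r 1"
  shows "(\<lambda>k. if k < N then 0 else a (k - N)) \<in> lp_ball r 1" (is "?a \<in> _")
proof -
  have a: "a \<in> coef_ball r" "r = \<infinity> \<Longrightarrow> a \<longlonglongrightarrow> 0" using assms lp_ball_1_iff[OF r_ge_1] by blast+
  have "(\<Sum>k<n. norm (?a k) powr R) \<le> 1" if "\<And>n. (\<Sum>k<n. norm (a k) powr R) \<le> 1" for n R
  proof -
    have "(\<Sum>k<n. norm (?a k) powr R) = (\<Sum>k\<in>{N..<n}. norm (a (k - N)) powr R)"
      by (intro sum.mono_neutral_cong_right) auto
    also have "\<dots> = (\<Sum>k<n-N. norm (a k) powr R)"
      by (rule sum.reindex_bij_witness[of _ "\<lambda>k. k + N" "\<lambda>k. k - N"]) auto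
    finally show ?thesis using that by simp
  qed
  moreover have "?a \<longlonglongrightarrow> 0" if "r = \<infinity>"
    by (rule LIMSEQ_offset[of _ N]) (use a(2)[OF that] in simp)
  ultimately show ?thesis using a by (subst lp_ball_1_iff[OF r_ge_1]) (auto simp: coef_ball_def)
qed

text \<open>The definition with \<open>\<epsilon> = 1\<close> covers all terms from some
  \<open>N\<close> on. The finitely many earlier terms are prepended to \<open>z\<close>, where unit
  coefficient vectors pick them out.\<close>

lemma pr_null_imp_rel_pr_compact:
  assumes "pr_null smul p r x"
  shows "rel_pr_compact smul p r (range x)"
proof -
  obtain z N where z: "z \<in> lp_ball p 1" and N: "\<And>n. n \<ge> N \<Longrightarrow> x n \<in> pr_conv smul r z"
    using assms unfolding pr_null_def by (meson zero_less_one)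
  have zs: "summable (\<lambda>k. norm (z k) powr P)"
    using z p_finite by (auto simp: lp_ball_def lp_seqs_def split: if_splits)
  define w where "w k = (if k < N then x k else z (k - N))" for k
  have "summable (\<lambda>k. norm (w (k + N)) powr P)" using zs by (simp add: w_def)
  then have "summable (\<lambda>k. norm (w k) powr P)"
    by (rule summable_iff_shift[of "\<lambda>k. norm (w k) powr P", THEN iffD1])
  then have "w \<in> lp_seqs p" using p_finite by (simp add: lp_seqs_def)
  moreover have "x n \<in> pr_conv smul r w" for n
  proof (cases "n < N")
    case True
    have "(\<lambda>k. smul (if k = n then 1 else 0) (w k)) sums x n"
      using sums_single[of n w] True by (simp add: w_def if_distrib[of "\<lambda>c. smul c _"] cong: if_cong)
    then show ?thesis by (rule pr_convI[OF unit_vector_in_lp_ball])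
  next
    case False
    then obtain a where a: "a \<in> lp_ball r 1" "(\<lambda>k. smul (a k) (z k)) sums x n"
      using N[of n] by (auto simp: pr_conv_def)
    have "(\<lambda>k. smul (if k < N then 0 else a (k - N)) (w k)) sums x n"
      by (subst sums_zero_iff_shift[of N, symmetric]) (use a(2) in \<open>auto simp: w_def\<close>)
    then show ?thesis by (rule pr_convI[OF shift_in_lp_ball[OF a(1)]])
  qed
  ultimately show ?thesis unfolding rel_pr_compact_def by blast
qed

section \<open>Rescaling coefficients and vectors for the converse\<close>

text \<open>The budget of 1 is split for finite \<open>r\<close>: \<open>M\<close> head entries of
  size at most \<open>1 / (2 * (M + 1))\<close> use at most 1/2, and the tail uses a quarter of each
  of the two power sums of \<open>a\<close> and \<open>b\<close>. The factor \<open>t\<close> makes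
  the result a null sequence.\<close>

lemma scaled_diff_in_lp_ball:
  fixes a b :: "nat \<Rightarrow> 'k" and t :: "nat \<Rightarrow> real"
  assumes a: "a \<in> coef_ball r" and b: "b \<in> coef_ball r"
    and t: "\<And>k. 0 < t k" "\<And>k. t k \<le> 1" "t \<longlonglongrightarrow> 0" and "\<delta> > 0"
    and near: "\<And>k. k < M \<Longrightarrow> norm (a k - b k) < \<delta> / (2 * (real M + 1))"
  shows "(\<lambda>k. of_real (t k / (if k < M then \<delta> else 8)) * (a k - b k)) \<in> lp_ball r 1" (is "?c \<in> _")
proof -
  have head: "norm (?c k) \<le> 1 / (2 * (real M + 1))" if "k < M" for k
  proof -
    have "norm (?c k) = t k * (norm (a k - b k) / \<delta>)"
      using that t(1)[of k] \<open>\<delta> > 0\<close> by (simp add: norm_mult norm_divide)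
    also have "\<dots> \<le> norm (a k - b k) / \<delta>"
      using t \<open>\<delta> > 0\<close> by (intro mult_left_le_one_le) (auto simp: less_imp_le)
    also have "\<dots> \<le> 1 / (2 * (real M + 1))"
      using near[OF that] \<open>\<delta> > 0\<close> by (simp add: field_simps less_imp_le)
    finally show ?thesis .
  qed
  have tail: "norm (?c k) \<le> (norm (a k) + norm (b k)) / 8" if "\<not> k < M" for k
  proof -
    have "norm (?c k) = t k * (norm (a k - b k) / 8)"
      using that t(1)[of k] by (simp add: norm_mult norm_divide)
    also have "\<dots> \<le> norm (a k - b k) / 8"
      using t by (intro mult_left_le_one_le) (auto simp: less_imp_le)
    finally show ?thesis using norm_triangle_ineq4[of "a k" "b k"] by simp
  qed
  note ab1 = norm_le_1_if_coef_ball[OF r_ge_1 a] norm_le_1_if_coef_ball[OF r_ge_1 b]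
  have c1: "norm (?c k) \<le> 1" for k
  proof (cases "k < M")
    case True
    have "1 / (2 * (real M + 1)) \<le> 1" by (simp add: field_simps)
    then show ?thesis using head[OF True] by linarith
  next
    case False
    have "(norm (a k) + norm (b k)) / 8 \<le> 1" using add_mono[OF ab1(1)[of k] ab1(2)[of k]] by simp
    then show ?thesis using tail[OF False] order.trans by blast
  qed
  have "?c \<in> coef_ball r"
  proof (cases "r = \<infinity>")
    case True
    then show ?thesis using c1 by (auto simp: coef_ball_def)
  next
    case False
    define R where "R = real_of_ereal r"
    have R: "R \<ge> 1" using r_ge_1 False by (cases r) (auto simp: R_def)
    have sums: "(\<Sum>k<n. norm (a k) powr R) \<le> 1" "(\<Sum>k<n. norm (b k) powr R) \<le> 1" for n
      using a b False by (auto simp: coef_ball_def R_def)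
    have hd: "norm (?c k) powr R \<le> 1 / (2 * (real M + 1))" if "k < M" for k
    proof -
      have "norm (?c k) powr R \<le> norm (?c k) powr 1" using c1 R by (intro powr_mono') auto
      then show ?thesis using head[OF that] by simp
    qed
    \<comment> \<open>The tail scale 8 is 2 times 4: the sum of two norms is at most twice their
      maximum, and the remaining 4 satisfies \<open>4 powr R \<ge> 4\<close> because
      \<open>R \<ge> 1\<close>.\<close>
    have tl: "norm (?c k) powr R \<le> (norm (a k) powr R + norm (b k) powr R) / 4" if "\<not> k < M" for k
    proof -
      let ?m = "max (norm (a k)) (norm (b k))"
      have "norm (?c k) \<le> (?m + ?m) / 8"
        by (rule order.trans[OF tail[OF that]]) (intro divide_right_mono add_mono; simp)
      then have "norm (?c k) powr R \<le> (?m / 4) powr R" using R by (intro powr_mono2) simp_all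
      also have "\<dots> = ?m powr R / 4 powr R" by (simp add: powr_divide)
      also have "\<dots> \<le> ?m powr R / 4 powr 1" using R by (intro divide_left_mono powr_mono) auto
      also have "\<dots> \<le> (norm (a k) powr R + norm (b k) powr R) / 4" by (simp add: max_def)
      finally show ?thesis .
    qed
    have "(\<Sum>k<n. norm (?c k) powr R) \<le> 1" for n
    proof -
      have "(\<Sum>k<n. norm (?c k) powr R) \<le>
          (\<Sum>k<n. (if k < M then 1 / (2 * (real M + 1)) else 0) + (norm (a k) powr R + norm (b k) powr R) / 4)"
        using hd tl by (intro sum_mono) (auto intro: add_increasing2)
      also have "\<dots> = (\<Sum>k<n. if k < M then 1 / (2 * (real M + 1)) else 0)
          + ((\<Sum>k<n. norm (a k) powr R) + (\<Sum>k<n. norm (b k) powr R)) / 4"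
        by (simp add: sum.distrib sum_divide_distrib add_divide_distrib)
      finally have "(\<Sum>k<n. norm (?c k) powr R) \<le> (\<Sum>k<n. if k < M then 1 / (2 * (real M + 1)) else 0)
          + ((\<Sum>k<n. norm (a k) powr R) + (\<Sum>k<n. norm (b k) powr R)) / 4" .
      moreover have "(\<Sum>k<n. if k < M then 1 / (2 * (real M + 1)) else 0) \<le> (\<Sum>k<M. 1 / (2 * (real M + 1)))"
        by (subst sum.inter_filter[symmetric], simp, intro sum_mono2) auto
      moreover have "\<dots> \<le> 1 / 2" by (simp add: field_simps)
      ultimately show ?thesis using sums[of n] by argo
    qed
    then show ?thesis using False by (auto simp: coef_ball_def R_def)
  qed
  moreover have "?c \<longlonglongrightarrow> 0"
  proof (rule Lim_null_comparison)
    \<comment> \<open>Differences of entries have norm at most 2, and division by the tail scale 8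
      leaves 1/4.\<close>
    show "(\<lambda>k. t k * (1 / 4)) \<longlonglongrightarrow> 0" using tendsto_mult_left_zero[OF t(3)] .
    show "\<forall>\<^sub>F k in sequentially. norm (?c k) \<le> t k * (1 / 4)"
    proof (rule eventually_sequentiallyI[of M])
      fix k assume "M \<le> k"
      then have "norm (?c k) = t k * (norm (a k - b k) / 8)"
        using t(1)[of k] by (simp add: norm_mult norm_divide)
      also have "\<dots> \<le> t k * (1 / 4)"
        using norm_triangle_ineq4[of "a k" "b k"] ab1[of k] t(1)[of k] by (intro mult_left_mono) auto
      finally show "norm (?c k) \<le> t k * (1 / 4)" .
    qed
  qed
  ultimately show ?thesis by (subst lp_ball_1_iff[OF r_ge_1]) auto
qed

text \<open>Head and tail each receive half of \<open>\<epsilon> powr P\<close>: \<open>M\<close> is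
  taken so late that the tail stays small even when enlarged by 8, and \<delta> shrinks the
  head.\<close>

lemma scaled_in_lp_ball:
  assumes w: "summable (\<lambda>k. norm (w k) powr P)" and "\<epsilon> > 0"
  obtains \<delta> M where "\<delta> > 0" "(\<lambda>k. smul (of_real (if k < M then \<delta> else 8)) (w k)) \<in> lp_ball p \<epsilon>"
proof -
  have P: "P > 0" using P_ge_1 by simp
  define W where "W = (\<Sum>k. norm (w k) powr P)"
  have W: "W \<ge> 0" unfolding W_def by (intro suminf_nonneg w) auto
  \<comment> \<open>Since \<open>W\<close> bounds every head sum, this \<delta> works for all
    \<open>M\<close>; the added 1 avoids a zero denominator.\<close>
  define \<delta> where "\<delta> = \<epsilon> / (2 * (W + 1)) powr (1 / P)"
  have \<delta>: "\<delta> > 0" "\<delta> powr P = \<epsilon> powr P / (2 * (W + 1))"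
    using \<open>\<epsilon> > 0\<close> W P by (auto simp: \<delta>_def powr_divide powr_powr)
  have "(\<epsilon> / 8) powr P / 2 > 0" using \<open>\<epsilon> > 0\<close> by simp
  from suminf_exist_split[OF this w] obtain M where "norm (\<Sum>k. norm (w (k + M)) powr P) < (\<epsilon> / 8) powr P / 2"
    by blast
  then have M: "(\<Sum>k. norm (w (k + M)) powr P) < (\<epsilon> / 8) powr P / 2" by simp
  let ?l = "\<lambda>k. if k < M then \<delta> else 8 :: real"
  let ?z = "\<lambda>k. smul (of_real (?l k)) (w k)"
  let ?f = "\<lambda>k. norm (?z k) powr P"
  have f_eq: "?f k = (?l k) powr P * norm (w k) powr P" for k
    using \<delta>(1) by (simp add: norm_scale powr_mult)
  have w_tail: "summable (\<lambda>k. norm (w (k + M)) powr P)"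
    using w by (simp add: summable_iff_shift[of "\<lambda>k. norm (w k) powr P"])
  have "summable (\<lambda>k. ?f (k + M))"
    unfolding f_eq using summable_mult[OF w_tail, of "8 powr P"] by simp
  then have f: "summable ?f" by (rule summable_iff_shift[of ?f, THEN iffD1])
  have "suminf ?f = (\<Sum>k. ?f (k + M)) + (\<Sum>k<M. ?f k)"
    by (rule suminf_split_initial_segment[OF f])
  also have "(\<Sum>k. ?f (k + M)) = 8 powr P * (\<Sum>k. norm (w (k + M)) powr P)"
    unfolding f_eq using suminf_mult[OF w_tail, of "8 powr P"] by simp
  also have "\<dots> \<le> 8 powr P * ((\<epsilon> / 8) powr P / 2)"
    using M by (intro mult_left_mono) auto
  also have "\<dots> = \<epsilon> powr P / 2" using \<open>\<epsilon> > 0\<close> by (simp add: powr_divide)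
  also have "(\<Sum>k<M. ?f k) = \<delta> powr P * (\<Sum>k<M. norm (w k) powr P)"
    unfolding f_eq by (simp add: sum_distrib_left)
  also have "\<dots> \<le> \<delta> powr P * (W + 1)"
    using sum_le_suminf[OF w, of "{..<M}"] by (intro mult_left_mono) (auto simp: W_def)
  also have "\<dots> = \<epsilon> powr P / 2" using W by (simp add: \<delta>(2) field_simps)
  finally have "suminf ?f \<le> \<epsilon> powr P" by simp
  then have "suminf ?f powr (1 / P) \<le> (\<epsilon> powr P) powr (1 / P)"
    using P by (intro powr_mono2 suminf_nonneg f) auto
  then have "suminf ?f powr (1 / P) \<le> \<epsilon>" using P \<open>\<epsilon> > 0\<close> by (simp add: powr_powr)
  then have "?z \<in> lp_ball p \<epsilon>" using f p_finite by (auto simp: lp_ball_def lp_seqs_def lp_norm_def)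
  then show thesis using \<delta>(1) that by blast
qed

lemma tendsto_0_imp_pr_null:
  assumes x: "x \<longlonglongrightarrow> 0" and K: "rel_pr_compact smul p r (range x)"
  shows "pr_null smul p r x"
  unfolding pr_null_def
proof (intro allI impI)
  fix \<epsilon> :: real assume "\<epsilon> > 0"
  obtain z where "z \<in> lp_seqs p" and xz: "range x \<subseteq> pr_conv smul r z"
    using K unfolding rel_pr_compact_def by blast
  then have z: "summable (\<lambda>k. norm (z k) powr P)" using p_finite by (auto simp: lp_seqs_def split: if_splits)
  have "\<forall>n. \<exists>a. a \<in> coef_ball r \<and> (\<lambda>k. smul (a k) (z k)) sums x n"
    using xz lp_ball_1_iff[OF r_ge_1] unfolding pr_conv_def by blast
  then obtain a where a: "\<And>n. a n \<in> coef_ball r" "\<And>n. (\<lambda>k. smul (a n k) (z k)) sums x n"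
    by metis
  obtain s where s: "\<And>k. 0 < s k" "\<And>k. s k \<le> 1" "s \<longlonglongrightarrow> 0" "summable (\<lambda>k. norm (z k) powr P / s k)"
    using summable_divide_null[OF z] by auto
  \<comment> \<open>The root of order \<open>P\<close> is taken so that dividing \<open>z\<close> by
    \<open>t\<close> divides the powers of the norms by \<open>s\<close>, which keeps them
    summable.\<close>
  define t where "t k = s k powr (1 / P)" for k
  have P: "P > 0" using P_ge_1 by simp
  have t: "0 < t k" "t k \<le> 1" "t k powr P = s k" for k
    using s(1,2)[of k] P by (auto simp: t_def powr_le1 powr_powr less_imp_le)
  have "t \<longlonglongrightarrow> 0 powr (1 / P)"
    unfolding t_def using P s(1) by (intro tendsto_powr2 s(3) tendsto_const) (auto simp: less_imp_le)
  then have t0: "t \<longlonglongrightarrow> 0" by simp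
  define w where "w k = smul (of_real (1 / t k)) (z k)" for k
  have "norm (w k) powr P = norm (z k) powr P / s k" for k
    using t[of k] by (simp add: w_def norm_scale norm_divide powr_divide)
  then have w: "summable (\<lambda>k. norm (w k) powr P)" using s(4) by simp
  obtain \<delta> M where \<delta>: "\<delta> > 0" and z': "(\<lambda>k. smul (of_real (if k < M then \<delta> else 8)) (w k)) \<in> lp_ball p \<epsilon>"
    (is "?z \<in> _")
    using scaled_in_lp_ball[OF w \<open>\<epsilon> > 0\<close>] by blast
  \<comment> \<open>Both \<delta> and \<open>M\<close> come from \<open>w\<close> and \<epsilon>
    alone, so the required closeness is fixed before \<open>N\<close> is chosen.\<close>
  have "\<delta> / (2 * (real M + 1)) > 0" using \<delta> by simp
  from eventually_near_kernel[OF z x a this, of M] obtain N where N: "\<And>n. n \<ge> N \<Longrightarrow>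
      \<exists>b \<in> coef_ball r. (\<lambda>k. smul (b k) (z k)) sums 0 \<and> (\<forall>k<M. norm (a n k - b k) < \<delta> / (2 * (real M + 1)))"
    unfolding eventually_sequentially by blast
  have "x n \<in> pr_conv smul r ?z" if n: "n \<ge> N" for n
  proof -
    obtain b where b: "b \<in> coef_ball r" "(\<lambda>k. smul (b k) (z k)) sums 0"
      "\<forall>k<M. norm (a n k - b k) < \<delta> / (2 * (real M + 1))" using N[OF n] by blast
    let ?c = "\<lambda>k. of_real (t k / (if k < M then \<delta> else 8)) * (a n k - b k)"
    have "?c \<in> lp_ball r 1"
      by (rule scaled_diff_in_lp_ball[OF a(1) b(1) t(1,2) t0 \<delta>]) (use b(3) in auto)
    \<comment> \<open>The factors \<open>t k\<close> and the head or tail scale cancel between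
      coefficient and vector; subtracting the series of \<open>b\<close>, which sums to 0, leaves
      \<open>x n\<close> unchanged.\<close>
    moreover have "smul (?c k) (?z k) = smul (a n k) (z k) - smul (b k) (z k)" for k
      using t(1)[of k] \<delta> by (simp add: w_def scale_left_diff_distrib[symmetric])
    then have "(\<lambda>k. smul (?c k) (?z k)) sums x n"
      using sums_diff[OF a(2)[of n] b(2)] by simp
    ultimately show ?thesis by (rule pr_convI)
  qed
  then show "\<exists>z\<in>lp_ball p \<epsilon>. \<exists>N. \<forall>n\<ge>N. x n \<in> pr_conv smul r z" using z' by blast
qed

end

theorem theorem1p3:
  fixes smul :: "'k::{real_normed_field, heine_borel} \<Rightarrow> 'a::banach \<Rightarrow> 'a"
    and p p_star r :: ereal
    and x :: "nat \<Rightarrow> 'a"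
  assumes "banach_space_over smul"
    and "1 \<le> p" and "p < \<infinity>"
    and "1 \<le> p_star" and "1 / p + 1 / p_star = 1"
    and "1 \<le> r" and "r \<le> p_star"
  shows "pr_null smul p r x \<longleftrightarrow> x \<longlonglongrightarrow> 0 \<and> rel_pr_compact smul p r (range x)"
proof -
  interpret pr_indices smul p p_star r
    using assms by (simp add: pr_indices_def pr_indices_axioms_def)
  show ?thesis
    using pr_null_imp_tendsto_0 pr_null_imp_rel_pr_compact tendsto_0_imp_pr_null by blast
qed

end
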